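(* Let $c>0$, $r_h>0$, $b>r_h/\sqrt2$ and $t_b\ge0$. For the extremal charged linear dilaton black hole (described in the context), the matter entropy per unit area without an island, for radiation regions bounded by the points $b_\mp$, equals $$S=\frac c3\log\left[\frac{2b^2-r_h^2}{b\,r_h}\,\cosh\frac{t_b}{r_h}\right].$$
   Context: The extremal charged linear dilaton black hole has, for $r>r_h/\sqrt2$ and after rescaling time by $r_h$, the metric $$ds^2=-\left(\frac{r}{r_h}\right)^2\left(1-\frac{r_h^2}{2r^2}\right)^2\left(dt^2-dr^{*2}\right)+r^2(dx^2+dy^2),\qquad r^*=\frac{r_h}{2}\left[\log\left(\frac{2r^2}{r_h^2}-1\right)-\frac{\frac{r_h^2}{2r^2}}{1-\frac{r_h^2}{2r^2}}\right].$$ A point of the right wedge with coordinates $(t,r)$ has null coordinates $u=-r_he^{-(t-r^* )/r_h}$, $v=r_he^{(t+r^* )/r_h}$; a point of the left wedge with coordinates $(t,r)$ has both signs flipped, $u=r_he^{-(t-r^* )/r_h}$, $v=-r_he^{(t+r^* )/r_h}$. In these coordinates the metric is $-e^{2\rho}du\,dv+r^2(dx^2+dy^2)$ with $$\rho=\log\left[\frac{r}{r_h}\left(1-\frac{r_h^2}{2r^2}\right)\right]-\frac{r^*}{r_h}.$$ The matter entropy per unit area without island is defined by the two-dimensional CFT formula (with central charge $c$) $$S=\frac{c}{12}\log\left[\frac{(u_{b_-}-u_{b_+})^2(v_{b_-}-v_{b_+})^2\,e^{2\rho(b_+)}e^{2\rho(b_-)}}{r_h^4}\right],$$ where $b_+$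 is the right-wedge point with $(t,r)=(t_b,b)$ and $b_-$ is the left-wedge point with $(t,r)=(-t_b,b)$. *)

theory Defs
  imports Complex_Main
begin

datatype wedge = LeftWedge | RightWedge

text \<open>A point of the exterior regions is given by its wedge and the coordinates \<open>(t, r)\<close>, with
  \<open>r > r_h / sqrt 2\<close>; the planar directions \<open>x, y\<close> are suppressed, since all entropies are
  per unit area. The time \<open>t\<close> is the one already rescaled by \<open>r_h\<close>.\<close>

datatype point = Point (wedge_of: wedge) (time_of: real) (radius_of: real)

text \<open>The metric is \<open>- warp r_h r * (dt^2 - dr*^2) + r^2 (dx^2 + dy^2)\<close>.\<close>

definition warp :: "real \<Rightarrow> real \<Rightarrow> real" where
  "warp r_h r = (r / r_h)^2 * (1 - r_h^2 / (2 * r^2))^2"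

definition tortoise :: "real \<Rightarrow> real \<Rightarrow> real" where
  "tortoise r_h r =
     r_h / 2 * (ln (2 * r^2 / r_h^2 - 1) - (r_h^2 / (2 * r^2)) / (1 - r_h^2 / (2 * r^2)))"

fun wedge_sign :: "wedge \<Rightarrow> real" where
  "wedge_sign RightWedge = 1"
| "wedge_sign LeftWedge = -1"

definition null_u :: "real \<Rightarrow> point \<Rightarrow> real" where
  "null_u r_h p =
     wedge_sign (wedge_of p) * (- r_h * exp (- (time_of p - tortoise r_h (radius_of p)) / r_h))"

definition null_v :: "real \<Rightarrow> point \<Rightarrow> real" where
  "null_v r_h p =
     wedge_sign (wedge_of p) * (r_h * exp ((time_of p + tortoise r_h (radius_of p)) / r_h))"

definition conformal_rho :: "real \<Rightarrow> point \<Rightarrow> real" where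
  "conformal_rho r_h p =
     ln (radius_of p / r_h * (1 - r_h^2 / (2 * (radius_of p)^2))) - tortoise r_h (radius_of p) / r_h"

text \<open>Consistency of \<^const>\<open>conformal_rho\<close> with the metric: along any curve \<open>s \<mapsto> (t s, r s)\<close>
  in either wedge, \<open>exp (2 rho) du dv = warp (dt^2 - dr*^2)\<close>.\<close>

lemma metric_null_form:
  fixes r_h s t' rs' :: real and t r :: "real \<Rightarrow> real" and w :: wedge
  assumes rh: "r_h > 0" and r: "r s > r_h / sqrt 2"
    and t: "(t has_real_derivative t') (at s)"
    and rs: "((\<lambda>s. tortoise r_h (r s)) has_real_derivative rs') (at s)"
  obtains u' v' where
    "((\<lambda>s. null_u r_h (Point w (t s) (r s))) has_real_derivative u') (at s)"
    "((\<lambda>s. null_v r_h (Point w (t s) (r s))) has_real_derivative v') (at s)"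
    "exp (2 * conformal_rho r_h (Point w (t s) (r s))) * u' * v' = warp r_h (r s) * (t'^2 - rs'^2)"
proof -
  define \<sigma> where "\<sigma> = wedge_sign w"
  define R where "R = tortoise r_h (r s)"
  have \<sigma>: "\<sigma> * \<sigma> = 1" unfolding \<sigma>_def by (cases w) auto
  define u' where "u' = \<sigma> * ((t' - rs') * exp (- (t s - R) / r_h))"
  define v' where "v' = \<sigma> * ((t' + rs') * exp ((t s + R) / r_h))"
  have du: "((\<lambda>s. null_u r_h (Point w (t s) (r s))) has_real_derivative u') (at s)"
    unfolding null_u_def u'_def \<sigma>_def R_def point.sel
    by (rule derivative_eq_intros t rs refl | (use rh in \<open>simp add: field_simps; fail\<close>))+
  have dv: "((\<lambda>s. null_v r_h (Point w (t s) (r s))) has_real_derivative v') (at s)"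
    unfolding null_v_def v'_def \<sigma>_def R_def point.sel
    by (rule derivative_eq_intros t rs refl | (use rh in \<open>simp add: field_simps; fail\<close>))+
  have pos: "r s > 0"
    using rh r by (meson divide_pos_pos less_trans real_sqrt_gt_zero zero_less_numeral)
  have "(r_h / sqrt 2)^2 < (r s)^2"
    using rh r by (intro power_strict_mono) auto
  then have "r_h^2 / (2 * (r s)^2) < 1"
    using pos by (simp add: power_divide field_simps)
  then have lpos: "r s / r_h * (1 - r_h^2 / (2 * (r s)^2)) > 0"
    using rh pos by simp
  have "exp (2 * conformal_rho r_h (Point w (t s) (r s)))
      = exp (ln (r s / r_h * (1 - r_h^2 / (2 * (r s)^2)))) ^ 2 * exp (- (2 * R / r_h))"
    unfolding conformal_rho_def R_def point.sel
    by (simp add: exp_double [symmetric] exp_add [symmetric] algebra_simps)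
  also have "\<dots> = warp r_h (r s) * exp (- (2 * R / r_h))"
    by (simp only: exp_ln [OF lpos] warp_def power_mult_distrib)
  finally have e: "exp (2 * conformal_rho r_h (Point w (t s) (r s)))
      = warp r_h (r s) * exp (- (2 * R / r_h))" .
  have x: "exp (- (2 * R / r_h)) * (exp (- (t s - R) / r_h) * exp ((t s + R) / r_h)) = 1"
    using rh by (simp add: exp_add [symmetric] field_simps)
  have "exp (2 * conformal_rho r_h (Point w (t s) (r s))) * u' * v'
      = warp r_h (r s) * ((\<sigma> * \<sigma>) * ((t' - rs') * (t' + rs'))
        * (exp (- (2 * R / r_h)) * (exp (- (t s - R) / r_h) * exp ((t s + R) / r_h))))"
    unfolding e u'_def v'_def by (simp only: mult_ac)
  also have "\<dots> = warp r_h (r s) * (t'^2 - rs'^2)"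
    unfolding x \<sigma> by (simp add: power2_eq_square algebra_simps)
  finally show ?thesis using du dv that by blast
qed

definition boundary_right :: "real \<Rightarrow> real \<Rightarrow> point" where
  "boundary_right t_b b = Point RightWedge t_b b"

definition boundary_left :: "real \<Rightarrow> real \<Rightarrow> point" where
  "boundary_left t_b b = Point LeftWedge (- t_b) b"

definition matter_entropy_without_island :: "real \<Rightarrow> real \<Rightarrow> real \<Rightarrow> real \<Rightarrow> real" where
  "matter_entropy_without_island c r_h t_b b =
     (let bp = boundary_right t_b b; bm = boundary_left t_b b in
      c / 12 * ln ((null_u r_h bm - null_u r_h bp)^2 * (null_v r_h bm - null_v r_h bp)^2
                   * exp (2 * conformal_rho r_h bp) * exp (2 * conformal_rho r_h bm) / r_h^4))"

end

theory Submission
  imports Defs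
begin

text \<open>The points \<open>b_-\<close> and \<open>b_+\<close> lie in opposite wedges at opposite
  times, so the differences of their null coordinates are, up to sign, sums of two exponentials,
  namely \<open>2 * r_h * exp (R / r_h) * cosh (t_b / r_h)\<close> with \<open>R\<close> the
  tortoise coordinate of \<open>b\<close> (\<open>null_u_separation\<close>,
  \<open>null_v_separation\<close>). Each conformal factor contributes
  \<open>exp (- R / r_h)\<close> times the square root of \<open>warp\<close>
  (\<open>exp_conformal_rho\<close>). The exponentials of \<open>R\<close> cancel, and the argument
  of the logarithm is a perfect fourth power, which turns \<open>c / 12\<close> into
  \<open>c / 3\<close>.\<close>

lemma exp_null_sum:
  fixes R t s :: real
  shows "exp ((R - t) / s) + exp ((R + t) / s) = 2 * exp (R / s) * cosh (t / s)"
  by (simp add: cosh_field_def add_divide_distrib diff_divide_distrib distrib_left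
      flip: exp_add)

text \<open>The flipped wedge sign makes the two values of \<open>u\<close> opposite in sign, and
  the flipped time gives their exponents opposite \<open>t\<close>.\<close>

lemma null_u_separation:
  "null_u r_h (boundary_left t b) - null_u r_h (boundary_right t b)
     = 2 * r_h * exp (tortoise r_h b / r_h) * cosh (t / r_h)"
proof -
  have "null_u r_h (boundary_left t b) - null_u r_h (boundary_right t b)
      = r_h * (exp ((tortoise r_h b - t) / r_h) + exp ((tortoise r_h b + t) / r_h))"
    by (simp add: null_u_def boundary_left_def boundary_right_def distrib_left add.commute)
  then show ?thesis
    by (simp add: exp_null_sum)
qed

lemma null_v_separation:
  "null_v r_h (boundary_left t b) - null_v r_h (boundary_right t b)
     = - (2 * r_h * exp (tortoise r_h b / r_h) * cosh (t / r_h))"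
proof -
  have "null_v r_h (boundary_left t b) - null_v r_h (boundary_right t b)
      = - (r_h * (exp ((tortoise r_h b - t) / r_h) + exp ((tortoise r_h b + t) / r_h)))"
    by (simp add: null_v_def boundary_left_def boundary_right_def distrib_left add.commute)
  then show ?thesis
    by (simp add: exp_null_sum)
qed

lemma exterior_radius:
  fixes r r_h :: real
  assumes "r_h > 0" and "r > r_h / sqrt 2"
  shows "r > 0" and "2 * r^2 - r_h^2 > 0"
proof -
  show "r > 0"
    using assms by (meson divide_pos_pos less_trans real_sqrt_gt_zero zero_less_numeral)
  have "(r_h / sqrt 2)^2 < r^2"
    using assms by (intro power_strict_mono) auto
  then show "2 * r^2 - r_h^2 > 0"
    by (simp add: power_divide)
qed

text \<open>Outside the horizon \<open>r_h / sqrt 2\<close> the argument of the logarithm in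
  \<open>conformal_rho\<close> is positive, so the exponential undoes it.\<close>

lemma exp_conformal_rho:
  assumes "r_h > 0" and "radius_of p > r_h / sqrt 2"
  shows "exp (conformal_rho r_h p)
     = (2 * (radius_of p)^2 - r_h^2) / (2 * radius_of p * r_h)
       * exp (- (tortoise r_h (radius_of p) / r_h))"
proof -
  have "radius_of p / r_h * (1 - r_h^2 / (2 * (radius_of p)^2))
      = (2 * (radius_of p)^2 - r_h^2) / (2 * radius_of p * r_h)"
    using assms(1) exterior_radius(1) [OF assms]
    by (simp add: divide_simps) (simp add: power2_eq_square algebra_simps)
  moreover have "(2 * (radius_of p)^2 - r_h^2) / (2 * radius_of p * r_h) > 0"
    using assms exterior_radius [OF assms] by simp
  moreover have "exp (ln x - y) = x * exp (- y)" if "x > 0" for x y :: real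
    using that by (simp add: exp_diff exp_minus divide_inverse)
  ultimately show ?thesis
    by (simp only: conformal_rho_def)
qed

theorem mainTheorem7:
  fixes c r_h b t_b :: real
  assumes "c > 0" and "r_h > 0" and "b > r_h / sqrt 2" and "t_b \<ge> 0"
  shows "matter_entropy_without_island c r_h t_b b
       = c / 3 * ln ((2 * b^2 - r_h^2) / (b * r_h) * cosh (t_b / r_h))"
proof -
  define L where "L = (2 * b^2 - r_h^2) / (2 * b * r_h)"
  define E where "E = exp (tortoise r_h b / r_h)"
  define C where "C = cosh (t_b / r_h)"
  have L: "L > 0"
    using assms exterior_radius [OF assms(2,3)] by (simp add: L_def)
  have C: "C > 0"
    by (simp add: C_def)
  have E: "E > 0"
    by (simp add: E_def)
  \<comment> \<open>The conformal factor depends only on the radius, so both boundary points share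
    this value.\<close>
  have rho: "exp (2 * conformal_rho r_h p) = (L / E)^2" if "radius_of p = b" for p
  proof -
    have "exp (conformal_rho r_h p) = L * exp (- (tortoise r_h b / r_h))"
      using exp_conformal_rho [of r_h p] assms(2,3) unfolding that L_def by blast
    also have "\<dots> = L / E"
      unfolding E_def exp_minus divide_inverse [of L] ..
    finally have "exp (conformal_rho r_h p) = L / E" .
    then show ?thesis
      by (simp add: exp_double)
  qed
  have "matter_entropy_without_island c r_h t_b b
      = c / 12 * ln ((2 * r_h * E * C)^2 * (- (2 * r_h * E * C))^2
          * (L / E)^2 * (L / E)^2 / r_h^4)"
    unfolding matter_entropy_without_island_def Let_def null_u_separation null_v_separation
    by (simp add: rho boundary_left_def boundary_right_def E_def C_def)
  \<comment> \<open>Squaring removes the sign of the \<open>v\<close> separation, so two separations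
    and two conformal factors, each squared, form one fourth power, in whose base \<open>E\<close>
    and \<open>r_h\<close> cancel.\<close>
  also have "(2 * r_h * E * C)^2 * (- (2 * r_h * E * C))^2 * (L / E)^2 * (L / E)^2 / r_h^4
      = (2 * r_h * E * C * (L / E) / r_h)^4"
    unfolding power2_eq_square power4_eq_xxxx
    by (simp only: minus_mult_minus times_divide_times_eq times_divide_eq_left
        times_divide_eq_right divide_divide_eq_left mult_ac)
  also have "2 * r_h * E * C * (L / E) / r_h = 2 * L * C"
    using assms(2) E by simp
  \<comment> \<open>The base is positive, so the exponent 4 comes out of the logarithm.\<close>
  also have "c / 12 * ln ((2 * L * C)^4) = c / 3 * ln (2 * L * C)"
    using L C by (simp add: ln_realpow)
  also have "2 * L = (2 * b^2 - r_h^2) / (b * r_h)"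
    unfolding L_def using assms(2) exterior_radius(1) [OF assms(2,3)] by (simp add: divide_simps)
  finally show ?thesis
    by (simp add: C_def)
qed

end
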